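(* Let $(\mathcal{H},d)$ be an Hadamard space, let $F\colon\mathcal{H}\to\mathcal{H}$ be a nonexpansive mapping with at least one fixed point, with resolvents $R_\lambda$, $\lambda\in(0,\infty)$, and let $(\lambda_n)_{n\in\mathbb{N}}\subset(0,\infty)$ be a sequence satisfying $\sum_n\lambda_n^2=\infty$. Given a point $x_0\in\mathcal{H}$, put $$x_n:=R_{\lambda_n}x_{n-1},\qquad n\in\mathbb{N}.$$ Then the sequence $(x_n)$ converges weakly to a fixed point of $F$.
   Context: An Hadamard space $(\mathcal{H},d)$ is a complete geodesic metric space satisfying $$d(x,\gamma_t)^2\le(1-t)d(x,\gamma_0)^2+t\,d(x,\gamma_1)^2-t(1-t)d(\gamma_0,\gamma_1)^2$$ for any $x\in\mathcal{H}$, any geodesic $\gamma\colon[0,1]\to\mathcal{H}$ and any $t\in[0,1]$. Any two points $x,y\in\mathcal{H}$ are joined by a unique geodesic, and for $t\in[0,1]$ one writes $(1-t)x+ty$ for the point $z$ on this geodesic with $d(x,z)=t\,d(x,y)$ and $d(z,y)=(1-t)d(x,y)$. A mapping $F\colon\mathcal{H}\to\mathcal{H}$ is nonexpansive if $d(Fx,Fy)\le d(x,y)$ for all $x,y\in\mathcal{H}$. Resolvent: for $x\in\mathcal{H}$ and $\lambda>0$, the mapping $G_{x,\lambda}\colon\mathcal{H}\to\mathcal{H}$, $G_{x,\lambda}(y)=\frac{1}{1+\lambda}x+\frac{\lambda}{1+\lambda}Fy$, is a strict contraction with Lipschitz constant $\frac{\lambda}{1+\lambda}$, and $R_\lambda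 x$ denotes its unique fixed point. The mapping $x\mapsto R_\lambda x$ is the resolvent of $F$. Weak convergence: for a bounded sequence $(x_n)\subset\mathcal{H}$, the function $x\mapsto\limsup_{n\to\infty}d(x,x_n)^2$ on $\mathcal{H}$ has a unique minimizer, called the asymptotic center of $(x_n)$. A bounded sequence $(x_n)$ converges weakly to $x\in\mathcal{H}$ if $x$ is the asymptotic center of each subsequence of $(x_n)$. *)

theory Defs
  imports "HOL-Analysis.Analysis"
begin

text \<open>Geodesics are parametrised on the unit interval, proportionally to arc length; values
  outside of it are irrelevant. Constant geodesics are allowed.\<close>

definition (in metric_space) geodesic :: "(real \<Rightarrow> 'a) \<Rightarrow> bool" where
  "geodesic \<gamma> \<longleftrightarrow>
     (\<forall>s\<in>{0..1}. \<forall>t\<in>{0..1}. dist (\<gamma> s) (\<gamma> t) = \<bar>s - t\<bar> * dist (\<gamma> 0) (\<gamma> 1))"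

class hadamard_space = complete_space +
  assumes geodesic_exists: "\<exists>\<gamma>. geodesic \<gamma> \<and> \<gamma> 0 = x \<and> \<gamma> 1 = y"
    and dist_geodesic_le: "geodesic \<gamma> \<Longrightarrow> t \<in> {0..1} \<Longrightarrow>
      (dist x (\<gamma> t))\<^sup>2 \<le> (1 - t) * (dist x (\<gamma> 0))\<^sup>2 + t * (dist x (\<gamma> 1))\<^sup>2
        - t * (1 - t) * (dist (\<gamma> 0) (\<gamma> 1))\<^sup>2"

text \<open>\<open>geo_comb t x y\<close> is the point written $(1-t)x + ty$; it is meant for $t \in [0,1]$.\<close>

definition geo_comb :: "real \<Rightarrow> 'a::hadamard_space \<Rightarrow> 'a \<Rightarrow> 'a" where
  "geo_comb t x y = (THE z. \<exists>\<gamma>. geodesic \<gamma> \<and> \<gamma> 0 = x \<and> \<gamma> 1 = y \<and> z \<in> \<gamma> ` {0..1} \<and>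
     dist x z = t * dist x y \<and> dist z y = (1 - t) * dist x y)"

definition resolvent_map :: "('a::hadamard_space \<Rightarrow> 'a) \<Rightarrow> real \<Rightarrow> 'a \<Rightarrow> 'a \<Rightarrow> 'a" where
  "resolvent_map F l x y = geo_comb (l / (1 + l)) x (F y)"

text \<open>For nonexpansive \<open>F\<close> and \<open>l > 0\<close> the map \<open>resolvent_map F l x\<close> is a strict contraction, so
  that the description below denotes its only fixed point.\<close>

definition resolvent :: "('a::hadamard_space \<Rightarrow> 'a) \<Rightarrow> real \<Rightarrow> 'a \<Rightarrow> 'a" where
  "resolvent F l x = (THE y. resolvent_map F l x y = y)"

text \<open>The limes superior is taken in the extended reals; for bounded sequences, the only ones
  considered here, it is finite.\<close>

definition asymptotic_radius_sq :: "(nat \<Rightarrow> 'a::metric_space) \<Rightarrow> 'a \<Rightarrow> ereal" where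
  "asymptotic_radius_sq X z = limsup (\<lambda>n. ereal ((dist z (X n))\<^sup>2))"

definition is_asymptotic_center :: "(nat \<Rightarrow> 'a::metric_space) \<Rightarrow> 'a \<Rightarrow> bool" where
  "is_asymptotic_center X c \<longleftrightarrow>
     (\<forall>z. asymptotic_radius_sq X c \<le> asymptotic_radius_sq X z) \<and>
     (\<forall>c'. (\<forall>z. asymptotic_radius_sq X c' \<le> asymptotic_radius_sq X z) \<longrightarrow> c' = c)"

definition converges_weakly :: "(nat \<Rightarrow> 'a::metric_space) \<Rightarrow> 'a \<Rightarrow> bool" where
  "converges_weakly X p \<longleftrightarrow> bounded (range X) \<and>
     (\<forall>r :: nat \<Rightarrow> nat. strict_mono r \<longrightarrow> is_asymptotic_center (X \<circ> r) p)"

end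

theory Submission
  imports Defs
begin

text \<open>For a fixed point \<open>p\<close> of \<open>F\<close>, the Hadamard inequality along the geodesic from
  $x_{n-1}$ to $F x_n$ gives
  $\lambda_n^2 d(x_n, F x_n)^2 \le d(p, x_{n-1})^2 - d(p, x_n)^2$, and $d(x_n, F x_n)$ is
  nonincreasing because $x_n$ lies on that geodesic. Since $\sum_n \lambda_n^2 = \infty$, it
  tends to zero, so that the asymptotic center of any subsequence is a fixed point. As $d(p, x_n)$
  converges for every fixed point \<open>p\<close>, the asymptotic radius at a fixed point is the same for all
  subsequences; hence all of them share the center of the full sequence.\<close>

section \<open>Geodesics and convex combinations\<close>

text \<open>With the two prescribed distances inserted, the right-hand side of the Hadamard
  inequality vanishes. As \<open>z\<close> may come from another geodesic with the same endpoints,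
  this also makes the description in \<open>geo_comb\<close> unambiguous.\<close>

lemma geodesic_point_unique:
  fixes z :: "'a::hadamard_space"
  assumes g: "geodesic \<gamma>" and t: "t \<in> {0..1}"
    and z0: "dist (\<gamma> 0) z = t * dist (\<gamma> 0) (\<gamma> 1)"
    and z1: "dist z (\<gamma> 1) = (1 - t) * dist (\<gamma> 0) (\<gamma> 1)"
  shows "z = \<gamma> t"
proof -
  let ?D = "dist (\<gamma> 0) (\<gamma> 1)"
  have "(dist z (\<gamma> t))\<^sup>2 \<le> (1 - t) * (t * ?D)\<^sup>2 + t * ((1 - t) * ?D)\<^sup>2 - t * (1 - t) * ?D\<^sup>2"
    using dist_geodesic_le[OF g t, of z] z0 z1 by (simp add: dist_commute)
  also have "\<dots> = 0"
    by (simp add: power2_eq_square algebra_simps)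
  finally show ?thesis by simp
qed

lemma dist_geodesic:
  fixes \<gamma> :: "real \<Rightarrow> 'a::metric_space"
  assumes g: "geodesic \<gamma>" and t: "t \<in> {0..1}"
  shows "dist (\<gamma> 0) (\<gamma> t) = t * dist (\<gamma> 0) (\<gamma> 1)"
    and "dist (\<gamma> t) (\<gamma> 1) = (1 - t) * dist (\<gamma> 0) (\<gamma> 1)"
proof -
  have "dist (\<gamma> s) (\<gamma> u) = \<bar>s - u\<bar> * dist (\<gamma> 0) (\<gamma> 1)" if "s \<in> {0..1}" "u \<in> {0..1}" for s u
    using g that unfolding geodesic_def by blast
  from this[of 0 t] this[of t 1] t
  show "dist (\<gamma> 0) (\<gamma> t) = t * dist (\<gamma> 0) (\<gamma> 1)"
    "dist (\<gamma> t) (\<gamma> 1) = (1 - t) * dist (\<gamma> 0) (\<gamma> 1)"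
    by auto
qed

lemma geo_comb_geodesic:
  fixes x y :: "'a::hadamard_space"
  assumes t: "t \<in> {0..1}"
  obtains \<gamma> where "geodesic \<gamma>" "\<gamma> 0 = x" "\<gamma> 1 = y" "geo_comb t x y = \<gamma> t"
proof -
  obtain \<gamma> where g: "geodesic \<gamma>" "\<gamma> 0 = x" "\<gamma> 1 = y"
    using geodesic_exists by blast
  have "geo_comb t x y = \<gamma> t"
    unfolding geo_comb_def
  proof (rule the_equality)
    show "\<exists>\<gamma>'. geodesic \<gamma>' \<and> \<gamma>' 0 = x \<and> \<gamma>' 1 = y \<and> \<gamma> t \<in> \<gamma>' ` {0..1} \<and>
        dist x (\<gamma> t) = t * dist x y \<and> dist (\<gamma> t) y = (1 - t) * dist x y"
      using g t dist_geodesic[OF g(1) t] by (intro exI[of _ \<gamma>]) simp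
  next
    fix z
    assume "\<exists>\<gamma>'. geodesic \<gamma>' \<and> \<gamma>' 0 = x \<and> \<gamma>' 1 = y \<and> z \<in> \<gamma>' ` {0..1} \<and>
        dist x z = t * dist x y \<and> dist z y = (1 - t) * dist x y"
    then have "dist x z = t * dist x y" "dist z y = (1 - t) * dist x y" by blast+
    then show "z = \<gamma> t"
      using g by (intro geodesic_point_unique[OF g(1) t]) simp_all
  qed
  with g show thesis by (rule that)
qed

lemma dist_geo_comb:
  fixes x y :: "'a::hadamard_space"
  assumes t: "t \<in> {0..1}"
  shows "dist x (geo_comb t x y) = t * dist x y"
    and "dist (geo_comb t x y) y = (1 - t) * dist x y"
proof -
  obtain \<gamma> where g: "geodesic \<gamma>" "\<gamma> 0 = x" "\<gamma> 1 = y" "geo_comb t x y = \<gamma> t"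
    using geo_comb_geodesic[OF t] .
  show "dist x (geo_comb t x y) = t * dist x y"
    "dist (geo_comb t x y) y = (1 - t) * dist x y"
    using dist_geodesic[OF g(1) t] unfolding g by simp_all
qed

lemma dist_geo_comb_sq_le:
  fixes x y w :: "'a::hadamard_space"
  assumes t: "t \<in> {0..1}"
  shows "(dist w (geo_comb t x y))\<^sup>2
    \<le> (1 - t) * (dist w x)\<^sup>2 + t * (dist w y)\<^sup>2 - t * (1 - t) * (dist x y)\<^sup>2"
proof -
  obtain \<gamma> where "geodesic \<gamma>" "\<gamma> 0 = x" "\<gamma> 1 = y" "geo_comb t x y = \<gamma> t"
    using geo_comb_geodesic[OF t] .
  then show ?thesis using dist_geodesic_le[of \<gamma> t w] t by simp
qed

text \<open>The Hadamard inequality is used twice: from \<open>geo_comb t x y\<close> to the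
  geodesic ending in \<open>y'\<close>, then from \<open>y'\<close> to the geodesic ending in
  \<open>y\<close>. All terms in \<open>dist x y\<close> and \<open>dist x y'\<close>
  cancel.\<close>

lemma dist_geo_comb_geo_comb_le:
  fixes x y y' :: "'a::hadamard_space"
  assumes t: "t \<in> {0..1}"
  shows "dist (geo_comb t x y) (geo_comb t x y') \<le> t * dist y y'"
proof (rule power2_le_imp_le)
  let ?z = "geo_comb t x y"
  have 1: "(dist ?z (geo_comb t x y'))\<^sup>2
      \<le> (1 - t) * (t * dist x y)\<^sup>2 + t * (dist ?z y')\<^sup>2 - t * (1 - t) * (dist x y')\<^sup>2"
    using dist_geo_comb_sq_le[OF t, of ?z x y'] dist_geo_comb(1)[OF t, of x y]
    by (simp add: dist_commute)
  have "(dist ?z y')\<^sup>2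
      \<le> (1 - t) * (dist x y')\<^sup>2 + t * (dist y y')\<^sup>2 - t * (1 - t) * (dist x y)\<^sup>2"
    using dist_geo_comb_sq_le[OF t, of y' x y] by (simp add: dist_commute)
  then have "t * (dist ?z y')\<^sup>2
      \<le> t * ((1 - t) * (dist x y')\<^sup>2 + t * (dist y y')\<^sup>2 - t * (1 - t) * (dist x y)\<^sup>2)"
    using t by (intro mult_left_mono) auto
  with 1 show "(dist ?z (geo_comb t x y'))\<^sup>2 \<le> (t * dist y y')\<^sup>2"
    by (simp add: power2_eq_square algebra_simps)
qed (use t in auto)

section \<open>Resolvents\<close>

text \<open>The previous estimate and nonexpansiveness give the contraction factor
  \<open>l / (1 + l) < 1\<close>, so Banach's theorem justifies the \<open>THE\<close> in
  \<open>resolvent\<close>.\<close>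

lemma resolvent_fixed_point:
  fixes F :: "'a::hadamard_space \<Rightarrow> 'a"
  assumes F: "\<And>u v. dist (F u) (F v) \<le> dist u v" and l: "l > 0"
  shows "geo_comb (l / (1 + l)) x (F (resolvent F l x)) = resolvent F l x"
proof -
  let ?t = "l / (1 + l)"
  have t: "?t \<in> {0..1}" "?t < 1" using l by auto
  have "dist (resolvent_map F l x y) (resolvent_map F l x y') \<le> ?t * dist y y'" for y y'
  proof -
    have "dist (resolvent_map F l x y) (resolvent_map F l x y') \<le> ?t * dist (F y) (F y')"
      unfolding resolvent_map_def by (rule dist_geo_comb_geo_comb_le[OF t(1)])
    also have "\<dots> \<le> ?t * dist y y'"
      using t(1) F by (intro mult_left_mono) auto
    finally show ?thesis .
  qed
  then have "\<exists>!y. resolvent_map F l x y = y"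
    using t by (intro banach_fix_type[of ?t]) auto
  then have "resolvent_map F l x (resolvent F l x) = resolvent F l x"
    unfolding resolvent_def by (rule theI')
  then show ?thesis by (simp add: resolvent_map_def)
qed

lemma dist_resolvent_sq_le:
  fixes F :: "'a::hadamard_space \<Rightarrow> 'a" and x :: 'a
  assumes F: "\<And>u v. dist (F u) (F v) \<le> dist u v" and l: "l > 0" and p: "F p = p"
  defines "y \<equiv> resolvent F l x"
  shows "(dist p y)\<^sup>2 + l\<^sup>2 * (dist y (F y))\<^sup>2 \<le> (dist p x)\<^sup>2"
proof -
  let ?t = "l / (1 + l)"
  have t: "?t \<in> {0..1}" "1 - ?t = 1 / (1 + l)" using l by (auto simp: field_simps)
  have y: "geo_comb ?t x (F y) = y"
    unfolding y_def by (rule resolvent_fixed_point[OF F l])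
  \<comment> \<open>The point \<open>y\<close> lies on the geodesic from \<open>x\<close> to
    \<open>F y\<close>, with the fraction \<open>1 / (1 + l)\<close> of its length left to
    \<open>F y\<close>.\<close>
  have D: "dist x (F y) = (1 + l) * dist y (F y)"
    using dist_geo_comb(2)[OF t(1), of x "F y"] l unfolding y t(2) by (simp add: field_simps)
  have "(dist p (F y))\<^sup>2 \<le> (dist p y)\<^sup>2"
    using F[of p y] p by (intro power_mono) auto
  then have Fy: "l * (dist p (F y))\<^sup>2 \<le> l * (dist p y)\<^sup>2"
    using l by (intro mult_left_mono) auto
  have "(dist p y)\<^sup>2 \<le> 1 / (1 + l) * (dist p x)\<^sup>2 + ?t * (dist p (F y))\<^sup>2
      - ?t * (1 / (1 + l)) * (dist x (F y))\<^sup>2"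
    using dist_geo_comb_sq_le[OF t(1), of p x "F y"] unfolding y t(2) .
  also have "\<dots> = ((dist p x)\<^sup>2 + l * (dist p (F y))\<^sup>2 - l * (1 + l) * (dist y (F y))\<^sup>2) / (1 + l)"
    using l unfolding D by (simp add: divide_simps) (simp add: power2_eq_square algebra_simps)
  finally have "(1 + l) * (dist p y)\<^sup>2
      \<le> (dist p x)\<^sup>2 + l * (dist p (F y))\<^sup>2 - l * (1 + l) * (dist y (F y))\<^sup>2"
    using l by (simp add: field_simps)
  moreover have "l * (dist y (F y))\<^sup>2 \<ge> 0" using l by simp
  ultimately show ?thesis using Fy by (simp add: power2_eq_square algebra_simps)
qed

text \<open>Going from \<open>x\<close> to \<open>F y\<close> through \<open>y\<close> is exact, and
  going through \<open>F x\<close> costs at most \<open>dist x (F x) + dist x y\<close>; the common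
  \<open>dist x y\<close> cancels.\<close>

lemma dist_resolvent_image_le:
  fixes F :: "'a::hadamard_space \<Rightarrow> 'a" and x :: 'a
  assumes F: "\<And>u v. dist (F u) (F v) \<le> dist u v" and l: "l > 0"
  defines "y \<equiv> resolvent F l x"
  shows "dist y (F y) \<le> dist x (F x)"
proof -
  have t: "l / (1 + l) \<in> {0..1}" using l by auto
  have y: "geo_comb (l / (1 + l)) x (F y) = y"
    unfolding y_def by (rule resolvent_fixed_point[OF F l])
  have "dist x y + dist y (F y) = dist x (F y)"
    using dist_geo_comb[OF t, of x "F y"] unfolding y by (simp add: algebra_simps)
  also have "\<dots> \<le> dist x (F x) + dist x y"
    using dist_triangle[of x "F y" "F x"] F[of x y] by simp
  finally show ?thesis by simp
qed

section \<open>Asymptotic radii and centers\<close>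

text \<open>This replaces the extended-real limsup by eventual real bounds. The margin
  \<open>s > r\<close> is essential, since single terms may exceed their limsup.\<close>

lemma asymptotic_radius_sq_le_iff:
  "asymptotic_radius_sq X z \<le> ereal r \<longleftrightarrow> (\<forall>s>r. \<forall>\<^sub>F n in sequentially. (dist z (X n))\<^sup>2 < s)"
proof
  assume le: "asymptotic_radius_sq X z \<le> ereal r"
  show "\<forall>s>r. \<forall>\<^sub>F n in sequentially. (dist z (X n))\<^sup>2 < s"
  proof (intro allI impI)
    fix s assume "r < s"
    then have "\<forall>\<^sub>F n in sequentially. ereal ((dist z (X n))\<^sup>2) < ereal s"
      by (intro Limsup_lessD le_less_trans[OF le[unfolded asymptotic_radius_sq_def]]) simp
    then show "\<forall>\<^sub>F n in sequentially. (dist z (X n))\<^sup>2 < s" by simp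
  qed
next
  assume *: "\<forall>s>r. \<forall>\<^sub>F n in sequentially. (dist z (X n))\<^sup>2 < s"
  show "asymptotic_radius_sq X z \<le> ereal r"
  proof (rule ereal_le_epsilon2)
    fix e :: real assume "e > 0"
    with * have "\<forall>\<^sub>F n in sequentially. (dist z (X n))\<^sup>2 < r + e" by simp
    then have "\<forall>\<^sub>F n in sequentially. ereal ((dist z (X n))\<^sup>2) \<le> ereal (r + e)"
      by eventually_elim simp
    then show "asymptotic_radius_sq X z \<le> ereal r + ereal e"
      unfolding asymptotic_radius_sq_def plus_ereal.simps by (rule Limsup_bounded)
  qed
qed

lemma asymptotic_radius_sq_le_imp_nonneg:
  assumes "asymptotic_radius_sq X z \<le> ereal r"
  shows "r \<ge> 0"
proof (rule ccontr)
  assume "\<not> r \<ge> 0"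
  then have "\<forall>\<^sub>F n in sequentially. (dist z (X n))\<^sup>2 < 0"
    using assms unfolding asymptotic_radius_sq_le_iff by (simp only: not_le)
  then show False by simp
qed

text \<open>The gain is the term \<open>t * (1 - t) = 1 / 4\<close> of the Hadamard inequality at
  the midpoint. It forces almost minimizing points to lie close together.\<close>

lemma asymptotic_radius_sq_midpoint_le:
  fixes X :: "nat \<Rightarrow> 'a::hadamard_space"
  assumes z: "asymptotic_radius_sq X z \<le> ereal r" and w: "asymptotic_radius_sq X w \<le> ereal r"
  shows "asymptotic_radius_sq X (geo_comb (1 / 2) z w) \<le> ereal (r - (dist z w)\<^sup>2 / 4)"
  unfolding asymptotic_radius_sq_le_iff
proof (intro allI impI)
  fix s assume "r - (dist z w)\<^sup>2 / 4 < s"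
  then have "s + (dist z w)\<^sup>2 / 4 > r" by simp
  then have "\<forall>\<^sub>F n in sequentially. (dist z (X n))\<^sup>2 < s + (dist z w)\<^sup>2 / 4
      \<and> (dist w (X n))\<^sup>2 < s + (dist z w)\<^sup>2 / 4"
    using z w unfolding asymptotic_radius_sq_le_iff by (intro eventually_conj) auto
  then show "\<forall>\<^sub>F n in sequentially. (dist (geo_comb (1 / 2) z w) (X n))\<^sup>2 < s"
  proof eventually_elim
    case (elim n)
    then show ?case
      using dist_geo_comb_sq_le[of "1 / 2" "X n" z w] by (simp add: dist_commute)
  qed
qed

text \<open>A limiting device with two uses: for the limit of a minimizing sequence, and for the
  image of a center under \<open>F\<close>.\<close>

lemma asymptotic_radius_sq_le_approx:
  assumes "\<And>e. e > 0 \<Longrightarrow> \<exists>w. asymptotic_radius_sq X w \<le> ereal (r + e) \<and>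
    (\<forall>\<^sub>F n in sequentially. dist z (X n) \<le> dist w (X n) + e)"
  shows "asymptotic_radius_sq X z \<le> ereal r"
  unfolding asymptotic_radius_sq_le_iff
proof (intro allI impI)
  fix s assume s: "r < s"
  have r: "r \<ge> 0"
  proof (rule field_le_epsilon)
    fix e :: real assume "e > 0"
    then obtain w where "asymptotic_radius_sq X w \<le> ereal (r + e)" using assms[of e] by blast
    then show "0 \<le> r + e" by (rule asymptotic_radius_sq_le_imp_nonneg)
  qed
  \<comment> \<open>This is the bound obtained below; \<open>2 * e\<close> instead of
    \<open>e\<close> provides the strict margin over the radius of \<open>w\<close>. The limit
    equals \<open>r\<close> because \<open>r\<close> is nonnegative.\<close>
  have lim: "((\<lambda>e. (sqrt (r + 2 * e) + e)\<^sup>2) \<longlongrightarrow> (sqrt (r + 2 * 0) + 0)\<^sup>2) (at_right 0)"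
    by (intro tendsto_power tendsto_add tendsto_real_sqrt tendsto_mult tendsto_const tendsto_ident_at)
  have "\<forall>\<^sub>F e in at_right 0. (sqrt (r + 2 * e) + e)\<^sup>2 < s"
    by (rule order_tendstoD(2)[OF lim]) (use s r in simp)
  then obtain b where b: "b > 0" "\<And>e. 0 < e \<Longrightarrow> e < b \<Longrightarrow> (sqrt (r + 2 * e) + e)\<^sup>2 < s"
    unfolding eventually_at_right_field by blast
  define e where "e = b / 2"
  have e: "e > 0" "(sqrt (r + 2 * e) + e)\<^sup>2 < s"
    using b(1) b(2)[of e] by (auto simp: e_def)
  obtain w where w: "asymptotic_radius_sq X w \<le> ereal (r + e)"
    "\<forall>\<^sub>F n in sequentially. dist z (X n) \<le> dist w (X n) + e"
    using assms[OF e(1)] by blast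
  have "\<forall>\<^sub>F n in sequentially. (dist w (X n))\<^sup>2 < r + 2 * e"
    using w(1) e(1) unfolding asymptotic_radius_sq_le_iff by simp
  with w(2) show "\<forall>\<^sub>F n in sequentially. (dist z (X n))\<^sup>2 < s"
  proof eventually_elim
    case (elim n)
    have "dist w (X n) \<le> sqrt (r + 2 * e)"
      using elim by (intro real_le_rsqrt) simp
    with elim have "dist z (X n) \<le> sqrt (r + 2 * e) + e" by simp
    then have "(dist z (X n))\<^sup>2 \<le> (sqrt (r + 2 * e) + e)\<^sup>2"
      by (intro power_mono) auto
    with e(2) show ?case by simp
  qed
qed

text \<open>Direct method: a minimizing sequence is Cauchy by the midpoint inequality, and its limit
  attains the infimum.\<close>

lemma asymptotic_center_exists:
  fixes X :: "nat \<Rightarrow> 'a::hadamard_space"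
  assumes "bounded (range X)"
  shows "\<exists>c. is_asymptotic_center X c"
proof -
  \<comment> \<open>Collecting real upper bounds of the radii makes the infimum a real
    number.\<close>
  define S where "S = {r. \<exists>z. asymptotic_radius_sq X z \<le> ereal r}"
  define R where "R = Inf S"
  have bdd: "bdd_below S"
    unfolding S_def using asymptotic_radius_sq_le_imp_nonneg by (intro bdd_belowI[of _ 0]) auto
  have "S \<noteq> {}"
  proof -
    obtain B where B: "dist (X 0) (X n) \<le> B" for n
      using assms unfolding bounded_any_center[where a = "X 0"] by auto
    have "asymptotic_radius_sq X (X 0) \<le> ereal (B\<^sup>2)"
      unfolding asymptotic_radius_sq_le_iff
      by (intro allI impI always_eventually) (rule le_less_trans[OF power_mono[OF B]], simp_all)
    then show ?thesis unfolding S_def by auto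
  qed
  have R_le: "R \<le> r" if "asymptotic_radius_sq X z \<le> ereal r" for r z
    unfolding R_def using that bdd by (intro cInf_lower) (auto simp: S_def)
  have R_approx: "\<exists>z. asymptotic_radius_sq X z \<le> ereal (R + e)" if "e > 0" for e
  proof -
    obtain r where "r \<in> S" "r < R + e"
      using cInf_lessD[OF \<open>S \<noteq> {}\<close>, of "R + e"] \<open>e > 0\<close> unfolding R_def by auto
    then obtain z where "asymptotic_radius_sq X z \<le> ereal r" unfolding S_def by auto
    also have "ereal r \<le> ereal (R + e)" using \<open>r < R + e\<close> by simp
    finally show ?thesis by blast
  qed
  \<comment> \<open>The radius at the midpoint cannot fall below \<open>R\<close>, hence
    \<open>R <= R + e - (dist z w)^2 / 4\<close>.\<close>
  have near: "(dist z w)\<^sup>2 \<le> 4 * e"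
    if "asymptotic_radius_sq X z \<le> ereal (R + e)" "asymptotic_radius_sq X w \<le> ereal (R + e)"
    for z w e
    using R_le[OF asymptotic_radius_sq_midpoint_le[OF that]] by simp
  have "\<forall>k. \<exists>z. asymptotic_radius_sq X z \<le> ereal (R + 1 / Suc k)"
    by (intro allI R_approx) simp
  then obtain c where c: "asymptotic_radius_sq X (c k) \<le> ereal (R + 1 / Suc k)" for k
    by metis
  have c_mono: "asymptotic_radius_sq X (c k) \<le> ereal (R + 1 / Suc N)" if "N \<le> k" for k N
    by (rule order_trans[OF c[of k]]) (use that in \<open>simp add: frac_le\<close>)
  have "Cauchy c"
  proof (rule metric_CauchyI)
    fix e :: real assume e: "e > 0"
    obtain N where N: "1 / Suc N < e\<^sup>2 / 4"
      using nat_approx_posE[of "e\<^sup>2 / 4"] e by auto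
    have "dist (c m) (c n) < e" if "m \<ge> N" "n \<ge> N" for m n
    proof (rule power2_less_imp_less)
      show "(dist (c m) (c n))\<^sup>2 < e\<^sup>2"
        using near[OF c_mono[OF that(1)] c_mono[OF that(2)]] N by simp
    qed (use e in simp)
    then show "\<exists>M. \<forall>m\<ge>M. \<forall>n\<ge>M. dist (c m) (c n) < e" by blast
  qed
  then obtain a where a: "c \<longlonglongrightarrow> a"
    using Cauchy_convergent convergent_def by blast
  have aR: "asymptotic_radius_sq X a \<le> ereal R"
  proof (rule asymptotic_radius_sq_le_approx)
    fix e :: real assume e: "e > 0"
    obtain N where N: "1 / Suc N < e" using nat_approx_posE[OF e] .
    obtain k where k: "k \<ge> N" "dist (c k) a < e"
      using metric_LIMSEQ_D[OF a e] by (metis nle_le)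
    have "asymptotic_radius_sq X (c k) \<le> ereal (R + e)"
      by (rule order_trans[OF c_mono[OF k(1)]]) (use N in simp)
    moreover have "dist a (X n) \<le> dist (c k) (X n) + e" for n
      using dist_triangle[of a "X n" "c k"] k(2) by (simp add: dist_commute)
    ultimately show "\<exists>w. asymptotic_radius_sq X w \<le> ereal (R + e) \<and>
        (\<forall>\<^sub>F n in sequentially. dist a (X n) \<le> dist w (X n) + e)"
      by auto
  qed
  have "is_asymptotic_center X a"
    unfolding is_asymptotic_center_def
  proof (intro conjI allI impI)
    fix z
    \<comment> \<open>Testing against all real upper bounds also covers an infinite radius.\<close>
    have "ereal R \<le> asymptotic_radius_sq X z"
      by (rule ereal_le_real) (use R_le in auto)
    with aR show "asymptotic_radius_sq X a \<le> asymptotic_radius_sq X z" by (rule order_trans)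
  next
    fix c' assume "\<forall>z. asymptotic_radius_sq X c' \<le> asymptotic_radius_sq X z"
    with aR have "asymptotic_radius_sq X c' \<le> ereal R" using order_trans by blast
    \<comment> \<open>With error \<open>0\<close>, \<open>near\<close> makes two exact minimizers
      coincide.\<close>
    then show "c' = a" using near[of c' 0 a] aR by simp
  qed
  then show ?thesis ..
qed

section \<open>Weak convergence of Fejer monotone sequences\<close>

text \<open>Passing through \<open>F (X n)\<close> gives
  \<open>dist (F c) (X n) <= dist c (X n) + dist (X n) (F (X n))\<close> with vanishing error. So
  \<open>F c\<close> is a minimizer too, and the minimizer is unique.\<close>

lemma asymptotic_center_fixed_point:
  assumes F: "\<And>u v. dist (F u) (F v) \<le> dist u v"
    and reg: "(\<lambda>n. dist (X n) (F (X n))) \<longlonglongrightarrow> 0"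
    and c: "is_asymptotic_center X c"
  shows "F c = c"
proof -
  have "asymptotic_radius_sq X (F c) \<le> asymptotic_radius_sq X c"
  proof (rule ereal_le_real)
    fix r assume r: "asymptotic_radius_sq X c \<le> ereal r"
    show "asymptotic_radius_sq X (F c) \<le> ereal r"
    proof (rule asymptotic_radius_sq_le_approx, intro exI conjI)
      fix e :: real assume e: "e > 0"
      show "asymptotic_radius_sq X c \<le> ereal (r + e)"
        by (rule order_trans[OF r]) (use e in simp)
      have "\<forall>\<^sub>F n in sequentially. dist (X n) (F (X n)) < e"
        using order_tendstoD(2)[OF reg e] .
      then show "\<forall>\<^sub>F n in sequentially. dist (F c) (X n) \<le> dist c (X n) + e"
      proof eventually_elim
        case (elim n)
        then show ?case
          using dist_triangle[of "F c" "X n" "F (X n)"] F[of c "X n"]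
          by (simp add: dist_commute)
      qed
    qed
  qed
  then show ?thesis using c unfolding is_asymptotic_center_def by (meson order_trans)
qed

text \<open>An Opial-type argument isolating what is used of the iteration: Fejer monotonicity with
  respect to the fixed points and asymptotic regularity.\<close>

lemma fejer_converges_weakly:
  fixes F :: "'a::hadamard_space \<Rightarrow> 'a"
  assumes F: "\<And>u v. dist (F u) (F v) \<le> dist u v"
    and fix_ex: "\<exists>p. F p = p"
    and fejer: "\<And>p. F p = p \<Longrightarrow> decseq (\<lambda>n. dist p (X n))"
    and reg: "(\<lambda>n. dist (X n) (F (X n))) \<longlonglongrightarrow> 0"
  shows "\<exists>p. F p = p \<and> converges_weakly X p"
proof -
  obtain q where q: "F q = q" using fix_ex by blast
  have bdd: "bounded (range X)"
    unfolding bounded_any_center[where a = q]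
    using decseqD[OF fejer[OF q], of 0] by auto
  \<comment> \<open>Monotone distances to \<open>p\<close> converge, so the limsup is a limit and
    passes to subsequences.\<close>
  have radius: "asymptotic_radius_sq (X \<circ> r) p = asymptotic_radius_sq X p"
    if p: "F p = p" and r: "strict_mono r" for p r
  proof -
    obtain L where "(\<lambda>n. dist p (X n)) \<longlonglongrightarrow> L"
      using decseq_convergent[OF fejer[OF p], of 0] by auto
    then have L: "(\<lambda>n. ereal ((dist p (X n))\<^sup>2)) \<longlonglongrightarrow> ereal (L\<^sup>2)"
      by (intro tendsto_intros)
    show ?thesis
      using lim_imp_Limsup[OF _ L] lim_imp_Limsup[OF _ LIMSEQ_subseq_LIMSEQ[OF L r]]
      by (simp add: asymptotic_radius_sq_def o_def)
  qed
  obtain c where c: "is_asymptotic_center X c"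
    using asymptotic_center_exists[OF bdd] ..
  have Fc: "F c = c" by (rule asymptotic_center_fixed_point[OF F reg c])
  have "is_asymptotic_center (X \<circ> r) c" if r: "strict_mono r" for r
  proof -
    have "bounded (range (X \<circ> r))" using bdd by (rule bounded_subset) auto
    then obtain c' where c': "is_asymptotic_center (X \<circ> r) c'"
      using asymptotic_center_exists by blast
    have "(\<lambda>n. dist ((X \<circ> r) n) (F ((X \<circ> r) n))) \<longlonglongrightarrow> 0"
      using LIMSEQ_subseq_LIMSEQ[OF reg r] by (simp add: o_def)
    then have "F c' = c'" using asymptotic_center_fixed_point[OF F _ c'] by blast
    \<comment> \<open>Both points are fixed, so \<open>radius\<close> reduces the comparison to the
      full sequence, where \<open>c\<close> is minimal.\<close>
    have "asymptotic_radius_sq (X \<circ> r) c \<le> asymptotic_radius_sq (X \<circ> r) c'"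
      using c unfolding radius[OF Fc r] radius[OF \<open>F c' = c'\<close> r] is_asymptotic_center_def
      by blast
    then have "c = c'"
      using c' unfolding is_asymptotic_center_def by (meson order_trans)
    with c' show ?thesis by simp
  qed
  with Fc bdd show ?thesis unfolding converges_weakly_def by blast
qed

section \<open>Iteration of resolvents\<close>

theorem proposition1p5:
  fixes F :: "'a::hadamard_space \<Rightarrow> 'a"
    and l :: "nat \<Rightarrow> real"
    and x0 :: 'a
    and x :: "nat \<Rightarrow> 'a"
  assumes nonexpansive: "\<And>u v. dist (F u) (F v) \<le> dist u v"
    and fixed_point: "\<exists>p. F p = p"
    and l_pos: "\<And>n. n \<ge> 1 \<Longrightarrow> l n > 0"
    and l_sum: "filterlim (\<lambda>N. \<Sum>n=1..N. (l n)\<^sup>2) at_top sequentially"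
    and x_0: "x 0 = x0"
    and x_step: "\<And>n. n \<ge> 1 \<Longrightarrow> x n = resolvent F (l n) (x (n - 1))"
  shows "\<exists>p. F p = p \<and> converges_weakly x p"
proof (rule fejer_converges_weakly[OF nonexpansive fixed_point])
  let ?d = "\<lambda>n. dist (x n) (F (x n))"
  have x_Suc: "x (Suc n) = resolvent F (l (Suc n)) (x n)" and l_Suc: "l (Suc n) > 0" for n
    using x_step[of "Suc n"] l_pos[of "Suc n"] by auto
  have step: "(dist p (x (Suc n)))\<^sup>2 + (l (Suc n))\<^sup>2 * (?d (Suc n))\<^sup>2 \<le> (dist p (x n))\<^sup>2"
    if "F p = p" for p n
    using dist_resolvent_sq_le[OF nonexpansive l_Suc that, of n "x n"] unfolding x_Suc[symmetric] .
  show "decseq (\<lambda>n. dist p (x n))" if p: "F p = p" for p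
  proof (rule decseq_SucI, rule power2_le_imp_le)
    fix n
    have "0 \<le> (l (Suc n))\<^sup>2 * (?d (Suc n))\<^sup>2" by simp
    with step[OF p, of n] show "(dist p (x (Suc n)))\<^sup>2 \<le> (dist p (x n))\<^sup>2" by linarith
  qed simp
  have dec: "decseq ?d"
    unfolding decseq_Suc_iff x_Suc using dist_resolvent_image_le[OF nonexpansive l_Suc] by blast
  obtain p where p: "F p = p" using fixed_point by blast
  \<comment> \<open>Telescoping of \<open>step\<close>; keeping the last distance on the left lets
    the induction go through.\<close>
  have sum_le: "(\<Sum>n=1..N. (l n)\<^sup>2 * (?d n)\<^sup>2) + (dist p (x N))\<^sup>2 \<le> (dist p (x 0))\<^sup>2" for N
  proof (induction N)
    case (Suc N)
    then show ?case using step[OF p, of N] by simp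
  qed simp
  show "?d \<longlonglongrightarrow> 0"
  proof (rule metric_LIMSEQ_I)
    fix e :: real assume e: "e > 0"
    \<comment> \<open>If \<open>?d N\<close> were at least \<open>e\<close>, monotonicity would give
      the same for all earlier indices, and this threshold would then contradict
      \<open>sum_le\<close>.\<close>
    obtain N where N: "(\<Sum>n=1..N. (l n)\<^sup>2) > (dist p (x 0))\<^sup>2 / e\<^sup>2"
      using l_sum unfolding filterlim_at_top_dense eventually_sequentially by blast
    have "?d N < e"
    proof (rule ccontr)
      assume "\<not> ?d N < e"
      then have "e\<^sup>2 \<le> (?d n)\<^sup>2" if "n \<le> N" for n
        using decseqD[OF dec that] e by (intro power_mono) auto
      then have "(\<Sum>n=1..N. (l n)\<^sup>2 * e\<^sup>2) \<le> (\<Sum>n=1..N. (l n)\<^sup>2 * (?d n)\<^sup>2)"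
        by (intro sum_mono mult_left_mono) auto
      also have "\<dots> \<le> (dist p (x 0))\<^sup>2"
        using sum_le[of N] zero_le_power2[of "dist p (x N)"] by linarith
      finally show False
        using N e by (simp add: sum_distrib_right[symmetric] divide_less_eq)
    qed
    then have "dist (?d n) 0 < e" if "n \<ge> N" for n
      using decseqD[OF dec that] by simp
    then show "\<exists>M. \<forall>n\<ge>M. dist (?d n) 0 < e" by blast
  qed
qed

end
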